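(* Let $I$ be an ideal and $P$ a prime ideal of $\mathbb{Q}[X]$, and let $F$ and $G$ be Gröbner bases of $I$ and $P$ respectively with respect to a monomial ordering $\prec$. Let $p$ be a prime number that is permissible for $(F,\prec)$ and for $(G,\prec)$ and satisfies $$(I_p(F):I_p(G))=\phi_p\bigl((I(F):I(G))\cap \mathbb{Z}_{(p)}[X]\bigr).$$ Let $K_{can}$ be a finite subset of $\mathbb{Q}[X]$. Then $P$ is a prime divisor of $I$ if the following conditions hold: 1. $p$ is permissible for $(K_{can},\prec)$; 2. $\phi_p(K_{can})$ is a Gröbner basis of $(I_p(F):(I_p(F):I_p(G)))$ with respect to $\prec$; 3. $(I_p(F):(I_p(F):I_p(G)))=I_p(G)$; 4. $K_{can}\subset P$.
   Context: $X=\{x_1,\ldots,x_n\}$ is a finite set of variables. For a prime number $p$, $\mathbb{Z}_{(p)}=\{a/b\in\mathbb{Q}\mid p\nmid b\}$ and $\phi_p:\mathbb{Z}_{(p)}[X]\to\mathbb{F}_p[X]$ is the canonical projection (reduction of coefficients modulo $p$). For $F\subset\mathbb{Q}[X]$, $I(F)$ is the ideal of $\mathbb{Q}[X]$ generated by $F$. For $F\subset \mathbb{Z}_{(p)}[X]$, $I_p(F)$ is the ideal of $\mathbb{F}_p[X]$ generated by $\phi_p(F)$. For ideals $A,B$ of a ring, $(A:B)=\{f\mid fB\subset A\}$. A prime $p$ is *permissible* for $(F,\prec)$ if $F\subset\mathbb{Z}_{(p)}[X]$ and $\phi_p(\mathrm{lc}_\prec(f))\neq 0$ for all $f\in F$,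 where $\mathrm{lc}_\prec(f)$ is the leading coefficient of $f$ with respect to $\prec$. A prime ideal $P$ is a *prime divisor* of $I$ if $P=\sqrt{Q}$ for some component $Q$ of an irredundant primary decomposition of $I$ (i.e. $P$ is an associated prime of $I$). *)

theory Defs
  imports "HOL-Library.Poly_Mapping" "Berlekamp_Zassenhaus.Finite_Field"
begin

section \<open>Ideals of commutative rings\<close>

text \<open>The ideals of a commutative ring are the submodules of the ring regarded as a module over
  itself.\<close>

lemma module_times: "Modules.module ((*) :: 'a::comm_ring_1 \<Rightarrow> 'a \<Rightarrow> 'a)"
  by unfold_locales (simp_all add: algebra_simps)

abbreviation is_ideal :: "'a::comm_ring_1 set \<Rightarrow> bool"
  where "is_ideal \<equiv> Modules.module.subspace (*)"

abbreviation ideal_gen :: "'a::comm_ring_1 set \<Rightarrow> 'a set"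
  where "ideal_gen \<equiv> Modules.module.span (*)"

definition colon :: "'a::comm_ring_1 set \<Rightarrow> 'a set \<Rightarrow> 'a set"
  where "colon A B = {f. \<forall>b\<in>B. f * b \<in> A}"

definition radical :: "'a::comm_ring_1 set \<Rightarrow> 'a set"
  where "radical I = {f. \<exists>n>0. f ^ n \<in> I}"

definition prime_ideal :: "'a::comm_ring_1 set \<Rightarrow> bool"
  where "prime_ideal P \<longleftrightarrow>
    is_ideal P \<and> P \<noteq> UNIV \<and> (\<forall>a b. a * b \<in> P \<longrightarrow> a \<in> P \<or> b \<in> P)"

definition primary_ideal :: "'a::comm_ring_1 set \<Rightarrow> bool"
  where "primary_ideal Q \<longleftrightarrow>
    is_ideal Q \<and> Q \<noteq> UNIV \<and> (\<forall>a b. a * b \<in> Q \<longrightarrow> a \<in> Q \<or> b \<in> radical Q)"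

text \<open>The empty family is the irredundant decomposition of the unit ideal, since
  \<open>\<Inter>{} = UNIV\<close>.\<close>

definition irredundant_primary_decomposition :: "'a::comm_ring_1 set set \<Rightarrow> 'a set \<Rightarrow> bool"
  where "irredundant_primary_decomposition QQ I \<longleftrightarrow>
    finite QQ \<and> (\<forall>Q\<in>QQ. primary_ideal Q) \<and> \<Inter>QQ = I \<and>
    (\<forall>Q\<in>QQ. \<not> \<Inter>(QQ - {Q}) \<subseteq> Q) \<and> inj_on radical QQ"

definition prime_divisor :: "'a::comm_ring_1 set \<Rightarrow> 'a set \<Rightarrow> bool"
  where "prime_divisor P I \<longleftrightarrow>
    prime_ideal P \<and> (\<exists>QQ. irredundant_primary_decomposition QQ I \<and> P \<in> radical ` QQ)"

section \<open>Multivariate polynomials, monomial orderings and Groebner bases\<close>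

text \<open>Monomials are exponent vectors, written additively; the variables are the elements of the
  index type.\<close>

type_synonym 'x monomial = "'x \<Rightarrow>\<^sub>0 nat"
type_synonym ('x, 'a) mpoly = "'x monomial \<Rightarrow>\<^sub>0 'a"

definition monomial_ordering :: "'x monomial rel \<Rightarrow> bool"
  where "monomial_ordering r \<longleftrightarrow>
    well_order r \<and> (\<forall>s t u. (s, t) \<in> r \<longrightarrow> (s + u, t + u) \<in> r)"

text \<open>For the zero polynomial the leading monomial is unspecified, but the leading coefficient and
  the leading term are zero.\<close>

definition lm :: "'x monomial rel \<Rightarrow> ('x, 'a::zero) mpoly \<Rightarrow> 'x monomial"
  where "lm r f = (THE t. t \<in> Poly_Mapping.keys f \<and> (\<forall>s\<in>Poly_Mapping.keys f. (s, t) \<in> r))"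

definition lc :: "'x monomial rel \<Rightarrow> ('x, 'a::zero) mpoly \<Rightarrow> 'a"
  where "lc r f = Poly_Mapping.lookup f (lm r f)"

definition lt :: "'x monomial rel \<Rightarrow> ('x, 'a::zero) mpoly \<Rightarrow> ('x, 'a) mpoly"
  where "lt r f = Poly_Mapping.single (lm r f) (lc r f)"

definition groebner_basis ::
    "'x monomial rel \<Rightarrow> ('x, 'a::field) mpoly set \<Rightarrow> ('x, 'a) mpoly set \<Rightarrow> bool"
  where "groebner_basis r F I \<longleftrightarrow>
    finite F \<and> F \<subseteq> I \<and> ideal_gen (lt r ` F) = ideal_gen (lt r ` I)"

section \<open>Reduction modulo a prime\<close>

text \<open>The prime \<open>p\<close> is the cardinality of a type \<open>'p\<close> of class \<^class>\<open>prime_card\<close>, so that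
  \<^typ>\<open>'p mod_ring\<close> is the field with \<open>p\<close> elements.\<close>

definition Z_loc :: "nat \<Rightarrow> rat set"
  where "Z_loc p = {of_int a / of_int b | a b. \<not> int p dvd b}"

definition Z_loc_poly :: "nat \<Rightarrow> ('x, rat) mpoly set"
  where "Z_loc_poly p = {f. \<forall>t. Poly_Mapping.lookup f t \<in> Z_loc p}"

text \<open>The reduction map is made total by using the reduced fraction of a rational number; it is only
  meaningful on \<^term>\<open>Z_loc CARD('p::prime_card)\<close>, where every admissible fraction gives the same
  value by the lemma below.\<close>

definition red_coeff :: "rat \<Rightarrow> 'p::prime_card mod_ring"
  where "red_coeff q = (case quotient_of q of (a, b) \<Rightarrow> of_int a / of_int b)"

lemma red_coeff_fraction:
  assumes "\<not> int CARD('p::prime_card) dvd b"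
  shows "red_coeff (of_int a / of_int b) = (of_int a / of_int b :: 'p mod_ring)"
proof -
  have zero_iff: "(of_int k :: 'p mod_ring) = 0 \<longleftrightarrow> int CARD('p) dvd k" for k
    unfolding of_int_of_int_mod_ring by transfer (simp add: dvd_eq_mod_eq_0)
  obtain c d where cd: "quotient_of (of_int a / of_int b) = (c, d)"
    by fastforce
  have "b \<noteq> 0" "d > 0"
    using assms quotient_of_denom_pos[OF cd] by auto
  then have cross: "a * d = c * b"
    using quotient_of_div[OF cd] by (simp add: field_simps flip: of_int_mult)
  have "coprime c d"
    using quotient_of_coprime[OF cd] .
  then have "d dvd b"
    using cross by (metis coprime_commute coprime_dvd_mult_right_iff dvd_triv_right)
  then have "\<not> int CARD('p) dvd d"
    using assms dvd_trans by blast
  moreover have "(of_int a * of_int d :: 'p mod_ring) = of_int c * of_int b"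
    using cross by (metis of_int_mult)
  ultimately show ?thesis
    using assms by (simp add: red_coeff_def cd zero_iff frac_eq_eq)
qed

definition red_poly :: "('x, rat) mpoly \<Rightarrow> ('x, 'p::prime_card mod_ring) mpoly"
  where "red_poly = Poly_Mapping.map red_coeff"

definition red_ideal :: "('x, rat) mpoly set \<Rightarrow> ('x, 'p::prime_card mod_ring) mpoly set"
  where "red_ideal F = ideal_gen (red_poly ` F)"

definition permissible ::
    "'p::prime_card itself \<Rightarrow> 'x monomial rel \<Rightarrow> ('x, rat) mpoly set \<Rightarrow> bool"
  where "permissible _ r F \<longleftrightarrow>
    F \<subseteq> Z_loc_poly CARD('p) \<and> (\<forall>f\<in>F. (red_coeff (lc r f) :: 'p mod_ring) \<noteq> 0)"

end

theory Submission
  imports Defs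
begin

text \<open>Put \<open>J = (I : (I : P))\<close>. If \<open>J \<subseteq> P\<close>, then \<open>P\<close> is the radical of a component of every irredundant
  primary decomposition of \<open>I\<close>. To see \<open>J \<subseteq> P\<close>, let \<open>f \<in> J\<close>. Division by \<open>G\<close> is possible over the
  local ring \<open>Z_(p)\<close>, since \<open>p\<close> is permissible; so we may replace \<open>f\<close> by its remainder, which is again
  in \<open>J\<close>, and scale a nonzero remainder so that its reduction modulo \<open>p\<close> is not zero. The hypotheses
  on the colon ideals put this reduction into \<open>I_p(G)\<close>, so the remainder is congruent modulo \<open>P\<close> to a
  multiple of \<open>p\<close>. By uniqueness of remainders it is itself a multiple of \<open>p\<close>, a contradiction.\<close>

section \<open>Primary decomposition in Noetherian rings\<close>

lemmas is_ideal_def = Modules.module.subspace_def[OF module_times]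
  and ideal_0 = Modules.module.subspace_0[OF module_times]
  and ideal_add = Modules.module.subspace_add[OF module_times]
  and ideal_diff = Modules.module.subspace_diff[OF module_times]
  and ideal_mult_left = Modules.module.subspace_scale[OF module_times]
  and ideal_Int = Modules.module.subspace_inter[OF module_times]
  and is_ideal_ideal_gen = Modules.module.subspace_span[OF module_times]
  and ideal_gen_superset = Modules.module.span_superset[OF module_times]
  and ideal_gen_minimal = Modules.module.span_minimal[OF module_times]

text \<open>The ascending chain condition, encoded as well-foundedness of reversed strict inclusion,
  so that it serves both as an induction rule and as a ban on infinite chains.\<close>

definition noetherian :: "'a::comm_ring_1 itself \<Rightarrow> bool"
  where "noetherian _ \<longleftrightarrow> wf {(B, A :: 'a set). is_ideal A \<and> is_ideal B \<and> A \<subset> B}"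

lemma ideal_mult_right: "is_ideal I \<Longrightarrow> f \<in> I \<Longrightarrow> f * g \<in> I"
  for I :: "'a::comm_ring_1 set"
  by (metis ideal_mult_left mult.commute)

lemma ideal_UNIV_iff: "is_ideal I \<Longrightarrow> I = UNIV \<longleftrightarrow> 1 \<in> I"
  for I :: "'a::comm_ring_1 set"
  by (metis UNIV_I UNIV_eq_I ideal_mult_right mult_1)

lemma is_ideal_colon: "is_ideal I \<Longrightarrow> is_ideal (colon I B)"
  for I :: "'a::comm_ring_1 set"
  unfolding colon_def
  by (subst is_ideal_def, auto simp: distrib_right mult.assoc ideal_0 ideal_add
      intro: ideal_mult_left)

text \<open>This lets elements of \<open>P\<close> be subtracted without leaving the double colon
  ideal.\<close>

lemma subset_double_colon: "P \<subseteq> colon I (colon I P)"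
  by (auto simp: colon_def mult.commute)

lemma is_ideal_add_principal:
  "is_ideal I \<Longrightarrow> is_ideal {q + c * a | q c. q \<in> I}"
  for I :: "'a::comm_ring_1 set"
proof -
  assume I: "is_ideal I"
  show ?thesis
    unfolding is_ideal_def
  proof (intro conjI ballI allI)
    show "0 \<in> {q + c * a | q c. q \<in> I}"
      using ideal_0[OF I] by (intro CollectI exI[of _ 0]) simp
  next
    fix x y assume "x \<in> {q + c * a | q c. q \<in> I}" "y \<in> {q + c * a | q c. q \<in> I}"
    then obtain q c q' c' where xy: "x = q + c * a" "y = q' + c' * a" and q: "q \<in> I" "q' \<in> I"
      by blast
    have "x + y = (q + q') + (c + c') * a"
      by (simp add: xy algebra_simps)
    with ideal_add[OF I q] show "x + y \<in> {q + c * a | q c. q \<in> I}"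
      by blast
  next
    fix x d assume "x \<in> {q + c * a | q c. q \<in> I}"
    then obtain q c where x: "x = q + c * a" and q: "q \<in> I"
      by blast
    have "d * x = d * q + (d * c) * a"
      by (simp add: x algebra_simps)
    with ideal_mult_left[OF I q, of d] show "d * x \<in> {q + c * a | q c. q \<in> I}"
      by blast
  qed
qed

section \<open>Existence of irredundant primary decompositions\<close>

definition irreducible_ideal :: "'a::comm_ring_1 set \<Rightarrow> bool"
  where "irreducible_ideal Q \<longleftrightarrow> is_ideal Q \<and> Q \<noteq> UNIV \<and>
    (\<forall>A B. is_ideal A \<and> is_ideal B \<and> A \<inter> B = Q \<longrightarrow> A = Q \<or> B = Q)"

text \<open>Noetherian induction: an ideal that is neither the whole ring nor irreducible is the
  intersection of two strictly larger ideals, and their decompositions are united.\<close>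

lemma irreducible_decomposition:
  fixes I :: "'a::comm_ring_1 set"
  assumes "noetherian TYPE('a)" "is_ideal I"
  shows "\<exists>QQ. finite QQ \<and> (\<forall>Q\<in>QQ. irreducible_ideal Q) \<and> \<Inter>QQ = I"
  using assms(1)[unfolded noetherian_def] assms(2)
proof (induction I rule: wf_induct_rule)
  case (less I)
  consider "I = UNIV" | "irreducible_ideal I"
    | A B where "is_ideal A" "is_ideal B" "A \<inter> B = I" "A \<noteq> I" "B \<noteq> I"
    using less.prems unfolding irreducible_ideal_def by blast
  then show ?case
  proof cases
    case 1
    then show ?thesis by (intro exI[of _ "{}"]) simp
  next
    case 2
    then show ?thesis by (intro exI[of _ "{I}"]) simp
  next
    case 3
    then have "I \<subset> A" "I \<subset> B" by blast+
    then obtain QA QB where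
      "finite QA" "\<forall>Q\<in>QA. irreducible_ideal Q" "\<Inter>QA = A"
      "finite QB" "\<forall>Q\<in>QB. irreducible_ideal Q" "\<Inter>QB = B"
      using less.IH[of A] less.IH[of B] less.prems 3 by auto
    then show ?thesis
      using 3 by (intro exI[of _ "QA \<union> QB"]) auto
  qed
qed

text \<open>If \<open>a * b \<in> Q\<close>, choose \<open>n\<close> with \<open>(Q : b^n) = (Q : b^(n+1))\<close>; then \<open>Q\<close> is the intersection of
  \<open>Q + (a)\<close> and \<open>Q + (b^n)\<close>.\<close>

lemma irreducible_imp_primary:
  fixes Q :: "'a::comm_ring_1 set"
  assumes N: "noetherian TYPE('a)" and Q: "irreducible_ideal Q"
  shows "primary_ideal Q"
proof -
  have id: "is_ideal Q" and ne: "Q \<noteq> UNIV"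
    using Q unfolding irreducible_ideal_def by auto
  have "a \<in> Q \<or> b \<in> radical Q" if ab: "a * b \<in> Q" for a b
  proof -
    define C where "C n = colon Q {b ^ n}" for n
    have idC: "is_ideal (C n)" for n
      unfolding C_def using id by (rule is_ideal_colon)
    have sub: "C n \<subseteq> C (Suc n)" for n
    proof
      fix c assume "c \<in> C n"
      then have "c * b ^ n \<in> Q"
        by (simp add: C_def colon_def)
      then have "b * (c * b ^ n) \<in> Q"
        by (rule ideal_mult_left[OF id])
      then show "c \<in> C (Suc n)"
        by (simp add: C_def colon_def ac_simps)
    qed
    have "\<not> (\<forall>n. (C (Suc n), C n) \<in> {(B, A). is_ideal A \<and> is_ideal B \<and> A \<subset> B})"
      using N unfolding noetherian_def wf_iff_no_infinite_down_chain
      by (rule contrapos_nn) (rule exI)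
    then obtain n where "\<not> C n \<subset> C (Suc n)"
      by (simp add: idC) blast
    then have "C (Suc n) = C n"
      using sub[of n] by blast
    then have stab: "c * b ^ n \<in> Q" if "c * b ^ Suc n \<in> Q" for c
      using that \<open>C (Suc n) = C n\<close> by (auto simp: C_def colon_def set_eq_iff)
    define A where "A = {q + c * a | q c. q \<in> Q}"
    define B where "B = {q + c * b ^ n | q c. q \<in> Q}"
    have idA: "is_ideal A" and idB: "is_ideal B"
      unfolding A_def B_def using id by (rule is_ideal_add_principal)+
    have "A \<inter> B = Q"
    proof (intro equalityI subsetI)
      fix y assume "y \<in> A \<inter> B"
      then obtain q c q' c' where y: "y = q + c * a" "y = q' + c' * b ^ n"
        and q: "q \<in> Q" "q' \<in> Q"
        unfolding A_def B_def by blast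
      \<comment> \<open>Two expressions for \<open>y * b\<close> are compared: the one from
        \<open>A\<close> lies in \<open>Q\<close> because \<open>a * b\<close> does, so the one from
        \<open>B\<close> yields \<open>c' * b ^ Suc n \<in> Q\<close>, where \<open>stab\<close>
        removes one factor \<open>b\<close>.\<close>
      have "q * b + c * (a * b) \<in> Q"
        using id ab q by (metis ideal_add ideal_mult_left mult.commute)
      then have "y * b \<in> Q"
        by (simp add: y(1) algebra_simps)
      moreover have "c' * b ^ Suc n = y * b - q' * b"
        by (simp add: y(2) algebra_simps)
      ultimately have "c' * b ^ Suc n \<in> Q"
        using id q by (metis ideal_diff ideal_mult_left mult.commute)
      then have "c' * b ^ n \<in> Q"
        by (rule stab)
      then show "y \<in> Q"
        using y(2) q ideal_add[OF id] by simp
    next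
      fix y assume "y \<in> Q"
      then have "y + 0 * a \<in> A" "y + 0 * b ^ n \<in> B"
        unfolding A_def B_def by blast+
      then show "y \<in> A \<inter> B"
        by simp
    qed
    then have "A = Q \<or> B = Q"
      using Q idA idB unfolding irreducible_ideal_def by blast
    moreover have "0 + 1 * a \<in> A" "0 + 1 * b ^ n \<in> B"
      unfolding A_def B_def using ideal_0[OF id] by blast+
    ultimately have "a \<in> Q \<or> b ^ n \<in> Q"
      by auto
    \<comment> \<open>\<open>radical\<close> asks for a positive exponent; exponent 0 would put 1
      into the proper ideal \<open>Q\<close>.\<close>
    moreover have "n > 0" if "b ^ n \<in> Q"
      using that ne ideal_UNIV_iff[OF id] by (cases n) auto
    ultimately show ?thesis
      unfolding radical_def by blast
  qed
  then show ?thesis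
    using id ne unfolding primary_ideal_def by blast
qed

text \<open>Serves to merge components with a common radical. Powers of \<open>x\<close> lying in
  \<open>A\<close> and in \<open>B\<close> multiply to a power lying in both, so
  \<open>radical A\<close> is inside the radical of the intersection.\<close>

lemma primary_ideal_Int:
  fixes A B :: "'a::comm_ring_1 set"
  assumes A: "primary_ideal A" and B: "primary_ideal B" and rad: "radical A = radical B"
  shows "primary_ideal (A \<inter> B)"
proof -
  have id: "is_ideal A" "is_ideal B"
    using A B by (auto simp: primary_ideal_def)
  have "x \<in> radical (A \<inter> B)" if x: "x \<in> radical A" for x
  proof -
    have "x \<in> radical B"
      using x rad by simp
    then obtain m n where "m > 0" "x ^ m \<in> A" "x ^ n \<in> B"
      using x unfolding radical_def by blast
    then have "x ^ (m + n) \<in> A \<inter> B" "m + n > 0"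
      using ideal_mult_right[OF id(1)] ideal_mult_left[OF id(2)]
      unfolding power_add by auto
    then show ?thesis
      unfolding radical_def by blast
  qed
  moreover have "a \<in> A \<or> b \<in> radical A" "a \<in> B \<or> b \<in> radical A" if "a * b \<in> A \<inter> B" for a b
    using that A B by (auto simp: primary_ideal_def rad)
  ultimately have "a \<in> A \<inter> B \<or> b \<in> radical (A \<inter> B)" if "a * b \<in> A \<inter> B" for a b
    using that by fast
  moreover have "A \<inter> B \<noteq> UNIV"
    using A by (auto simp: primary_ideal_def)
  ultimately show ?thesis
    using ideal_Int[OF id] by (simp add: primary_ideal_def)
qed

lemma irredundant_primary_decomposition_exists:
  fixes I :: "'a::comm_ring_1 set"
  assumes N: "noetherian TYPE('a)" and I: "is_ideal I"
  shows "\<exists>QQ. irredundant_primary_decomposition QQ I"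
proof -
  define D where "D QQ \<longleftrightarrow> finite QQ \<and> (\<forall>Q\<in>QQ. primary_ideal Q) \<and> \<Inter>QQ = I" for QQ
  obtain QQ0 where "D QQ0"
    using irreducible_decomposition[OF N I] irreducible_imp_primary[OF N] unfolding D_def by blast
  then obtain QQ where D: "D QQ" and min: "\<And>RR. D RR \<Longrightarrow> card QQ \<le> card RR"
    using ex_has_least_nat[of D QQ0 card] by blast
  have fin: "finite QQ"
    using D by (simp add: D_def)
  have "\<not> \<Inter>(QQ - {Q}) \<subseteq> Q" if Q: "Q \<in> QQ" for Q
  proof
    assume sub: "\<Inter>(QQ - {Q}) \<subseteq> Q"
    have "\<Inter>QQ = Q \<inter> \<Inter>(QQ - {Q})"
      using Q by blast
    then have "D (QQ - {Q})"
      using D sub by (auto simp: D_def)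
    then show False
      using min[of "QQ - {Q}"] card_Diff1_less[OF fin Q] by simp
  qed
  moreover have "inj_on radical QQ"
  proof (rule inj_onI, rule ccontr)
    fix A B assume AB: "A \<in> QQ" "B \<in> QQ" "radical A = radical B" "A \<noteq> B"
    define RR where "RR = insert (A \<inter> B) (QQ - {A, B})"
    have "\<Inter>RR = \<Inter>QQ"
      using AB by (auto simp: RR_def)
    then have "D RR"
      using D AB primary_ideal_Int[of A B] by (auto simp: D_def RR_def)
    moreover have "card RR < card QQ"
    proof -
      have "card RR \<le> Suc (card (QQ - {A, B}))"
        unfolding RR_def using fin by (simp add: card_insert_if)
      moreover have "card (QQ - {A, B}) = card QQ - 2"
        using AB fin by (subst card_Diff_subset) auto
      \<comment> \<open>Rules out truncation in the natural number
        \<open>card QQ - 2\<close>.\<close>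
      moreover have "card {A, B} \<le> card QQ"
        using AB fin by (intro card_mono) auto
      ultimately show ?thesis
        using AB by simp
    qed
    ultimately show False
      using min[of RR] by simp
  qed
  ultimately show ?thesis
    using D unfolding irredundant_primary_decomposition_def D_def by blast
qed

section \<open>Prime divisors detected by double colon ideals\<close>

lemma prime_ideal_power_notin: "prime_ideal P \<Longrightarrow> x \<notin> P \<Longrightarrow> x ^ n \<notin> P"
proof (induction n)
  case 0
  then show ?case
    using ideal_UNIV_iff[of P] by (auto simp: prime_ideal_def)
qed (auto simp: prime_ideal_def)

lemma prime_ideal_prod_notin:
  assumes "prime_ideal P" "finite A" "\<And>a. a \<in> A \<Longrightarrow> f a \<notin> P"
  shows "prod f A \<notin> P"
  using assms(2,1,3)
proof (induction A rule: finite_induct)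
  case empty
  then show ?case
    using ideal_UNIV_iff[of P] by (auto simp: prime_ideal_def)
qed (auto simp: prime_ideal_def)

text \<open>If \<open>P\<close> is not among the radicals, let \<open>s \<notin> P\<close> lie in every component \<open>Q\<close> whose radical is not
  inside \<open>P\<close>. The other components satisfy \<open>(Q : P) = Q\<close>, so \<open>s\<close> multiplies \<open>(I : P)\<close> into \<open>I\<close>.\<close>

lemma prime_divisorI:
  fixes I P :: "'a::comm_ring_1 set"
  assumes N: "noetherian TYPE('a)" and I: "is_ideal I" and P: "prime_ideal P"
    and sub: "colon I (colon I P) \<subseteq> P"
  shows "prime_divisor P I"
proof -
  obtain QQ where QQ: "irredundant_primary_decomposition QQ I"
    using irredundant_primary_decomposition_exists[OF N I] by blast
  then have fin: "finite QQ" and prim: "\<And>Q. Q \<in> QQ \<Longrightarrow> primary_ideal Q" and Inter: "\<Inter>QQ = I"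
    by (auto simp: irredundant_primary_decomposition_def)
  have "P \<in> radical ` QQ"
  proof (rule ccontr)
    assume notin: "P \<notin> radical ` QQ"
    define B where "B = {Q \<in> QQ. \<not> radical Q \<subseteq> P}"
    \<comment> \<open>Some power of an element of \<open>radical Q\<close> outside \<open>P\<close>
      lies in \<open>Q\<close>, and primality of \<open>P\<close> keeps that power outside
      \<open>P\<close>.\<close>
    have "\<exists>s. s \<in> Q \<and> s \<notin> P" if Q: "Q \<in> B" for Q
    proof -
      obtain x n where "x \<notin> P" "x ^ n \<in> Q"
        using Q by (auto simp: B_def radical_def)
      then show ?thesis
        using prime_ideal_power_notin[OF P] by blast
    qed
    then obtain s where s: "\<And>Q. Q \<in> B \<Longrightarrow> s Q \<in> Q" "\<And>Q. Q \<in> B \<Longrightarrow> s Q \<notin> P"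
      by metis
    have finB: "finite B"
      using fin by (simp add: B_def)
    have "prod s B \<in> colon I (colon I P)"
      unfolding colon_def[of I "colon I P"]
    proof (intro CollectI ballI)
      fix x assume x: "x \<in> colon I P"
      have "prod s B * x \<in> Q" if Q: "Q \<in> QQ" for Q
      proof (cases "Q \<in> B")
        case True
        have "is_ideal Q"
          using prim[OF Q] by (simp add: primary_ideal_def)
        moreover have "prod s B * x = s Q * (prod s (B - {Q}) * x)"
          unfolding prod.remove[OF finB True, of s] by (rule mult.assoc)
        ultimately show ?thesis
          using s(1)[OF True] by (simp add: ideal_mult_right)
      next
        case False
        \<comment> \<open>Here \<open>radical Q\<close> lies in \<open>P\<close> and differs from
          it, as \<open>P\<close> is not one of the radicals. With \<open>b\<close> in
          \<open>P\<close> but outside \<open>radical Q\<close>, the primary condition cancels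
          \<open>b\<close> from \<open>x * b\<close>.\<close>
        then have "radical Q \<subset> P"
          using Q notin by (auto simp: B_def)
        then obtain b where b: "b \<in> P" "b \<notin> radical Q"
          by blast
        have "x * b \<in> Q"
          using x b Inter Q by (auto simp: colon_def)
        then have "x \<in> Q"
          using prim[OF Q] b by (auto simp: primary_ideal_def)
        then show ?thesis
          using prim[OF Q] by (simp add: primary_ideal_def ideal_mult_left)
      qed
      then show "prod s B * x \<in> I"
        using Inter by blast
    qed
    moreover have "prod s B \<notin> P"
      using prime_ideal_prod_notin[OF P finB] s(2) by blast
    ultimately show False
      using sub by blast
  qed
  then show ?thesis
    using P QQ unfolding prime_divisor_def by blast
qed

section \<open>Polynomial rings are Noetherian\<close>

text \<open>Subtraction of exponent vectors truncates, so \<open>k - u\<close> is a quotient of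
  monomials only when \<open>u\<close> divides \<open>k\<close>; the case distinction reflects
  this.\<close>

lemma lookup_single_mult:
  fixes h :: "('x, 'a::semiring_0) mpoly"
  shows "Poly_Mapping.lookup (Poly_Mapping.single u c * h) k =
    (if \<exists>s. k = u + s then c * Poly_Mapping.lookup h (k - u) else 0)"
proof (cases "\<exists>s. k = u + s")
  case True
  then obtain s where k: "k = u + s" by blast
  have "Poly_Mapping.lookup (Poly_Mapping.single u c * h) (u + s) = c * Poly_Mapping.lookup h s"
    by (simp add: lookup_mult lookup_single when_mult)
  with k show ?thesis by auto
next
  case False
  then have "k \<notin> Poly_Mapping.keys (Poly_Mapping.single u c * h)"
    using keys_mult[of "Poly_Mapping.single u c" h] by (auto split: if_splits)
  with False show ?thesis
    by (simp add: not_in_keys_iff_lookup_eq_zero)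
qed

lemma lookup_single_0_mult:
  fixes h :: "('x, 'a::semiring_0) mpoly"
  shows "Poly_Mapping.lookup (Poly_Mapping.single 0 c * h) k = c * Poly_Mapping.lookup h k"
  by (simp add: lookup_single_mult)

text \<open>Passing to subsequences one variable at a time makes every exponent nondecreasing, after
  which the first of the remaining monomials divides the second.\<close>

lemma dickson_lemma:
  fixes s :: "nat \<Rightarrow> 'x::finite monomial"
  shows "\<exists>i j u. i < j \<and> s j = u + s i"
proof -
  have "\<exists>f :: nat \<Rightarrow> nat. strict_mono f \<and>
      (\<forall>x\<in>A. \<forall>i j. i \<le> j \<longrightarrow> Poly_Mapping.lookup (s (f i)) x \<le> Poly_Mapping.lookup (s (f j)) x)"
    if "finite A" for A :: "'x set"
    using that
  proof induction
    case empty
    then show ?case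
      by (auto intro: exI[of _ id] simp: strict_mono_def)
  next
    case (insert a A)
    then obtain f :: "nat \<Rightarrow> nat" where f: "strict_mono f" and
      A: "\<And>x i j. x \<in> A \<Longrightarrow> i \<le> j \<Longrightarrow>
        Poly_Mapping.lookup (s (f i)) x \<le> Poly_Mapping.lookup (s (f j)) x"
      by blast
    define v where "v n = Poly_Mapping.lookup (s (f n)) a" for n
    obtain g :: "nat \<Rightarrow> nat" where g: "strict_mono g" and mon: "\<And>i j. i \<le> j \<Longrightarrow> v (g i) \<le> v (g j)"
    proof -
      obtain g :: "nat \<Rightarrow> nat" where g: "strict_mono g" "monoseq (\<lambda>n. v (g n))"
        using seq_monosub by blast
      show ?thesis
      proof (cases "\<forall>m. \<forall>n\<ge>m. v (g m) \<le> v (g n)")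
        case True
        then show ?thesis using that[OF g(1)] by simp
      next
        case False
        then have dec: "\<forall>m. \<forall>n\<ge>m. v (g n) \<le> v (g m)"
          using g(2) unfolding monoseq_def by argo
        \<comment> \<open>A nonincreasing sequence of naturals is constant from the index
          \<open>N\<close> of its minimum on, so the shifted subsequence is nondecreasing as
          well.\<close>
        define N where "N = (ARG_MIN (\<lambda>n. v (g n)) n. True)"
        have N: "v (g N) \<le> v (g n)" for n
          unfolding N_def by (rule arg_min_nat_le) simp
        have "v (g (i + N)) = v (g N)" for i
          using N[of "i + N"] dec[rule_format, of N "i + N"] by simp
        moreover have "strict_mono (\<lambda>i. g (i + N))"
          using g(1) by (simp add: strict_mono_def)
        ultimately show ?thesis
          using that[of "\<lambda>i. g (i + N)"] by simp
      qed
    qed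
    have "strict_mono (f \<circ> g)"
      using f g by (rule strict_mono_o)
    moreover have "Poly_Mapping.lookup (s ((f \<circ> g) i)) x \<le> Poly_Mapping.lookup (s ((f \<circ> g) j)) x"
      if "x \<in> insert a A" "i \<le> j" for x i j
      using that mon[of i j] A[of x "g i" "g j"] strict_mono_less_eq[OF g] by (auto simp: v_def)
    ultimately show ?case
      by blast
  qed
  from this[of UNIV] obtain f :: "nat \<Rightarrow> nat" where f: "strict_mono f" and
    le: "\<And>x i j. i \<le> j \<Longrightarrow> Poly_Mapping.lookup (s (f i)) x \<le> Poly_Mapping.lookup (s (f j)) x"
    by auto
  \<comment> \<open>All exponents compare, so the truncated subtraction is exact here.\<close>
  have "s (f 1) = (s (f 1) - s (f 0)) + s (f 0)"
    by (rule poly_mapping_eqI) (use le[of 0 1] in \<open>simp add: lookup_add lookup_minus\<close>)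
  moreover have "f 0 < f 1"
    using f by (simp add: strict_mono_def)
  ultimately show ?thesis
    by blast
qed

section \<open>Monomial orderings and leading monomials\<close>

lemma monomial_ordering_add: "monomial_ordering r \<Longrightarrow> (s, t) \<in> r \<Longrightarrow> (u + s, u + t) \<in> r"
  by (simp add: monomial_ordering_def add.commute)

lemma monomial_ordering_wf: "monomial_ordering r \<Longrightarrow> wf (r - Id)"
  by (simp add: monomial_ordering_def well_order_on_def)

lemma monomial_ordering_linear:
  assumes "monomial_ordering r"
  shows "(s, s) \<in> r" and "(s, t) \<in> r \<Longrightarrow> (t, u) \<in> r \<Longrightarrow> (s, u) \<in> r"
    and "(s, t) \<in> r \<Longrightarrow> (t, s) \<in> r \<Longrightarrow> s = t" and "(s, t) \<in> r \<or> (t, s) \<in> r"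
proof -
  have L: "refl r" "trans r" "antisym r" "total r"
    using assms by (auto simp: monomial_ordering_def well_order_on_def linear_order_on_def
        partial_order_on_def preorder_on_def)
  show refl: "(s, s) \<in> r"
    using L(1) by (simp add: refl_on_def)
  show "(s, t) \<in> r \<Longrightarrow> (t, u) \<in> r \<Longrightarrow> (s, u) \<in> r"
    using L(2) by (rule transD)
  show "(s, t) \<in> r \<Longrightarrow> (t, s) \<in> r \<Longrightarrow> s = t"
    using L(3) by (rule antisymD)
  show "(s, t) \<in> r \<or> (t, s) \<in> r"
    using L(4) refl by (cases "s = t") (auto simp: total_on_def)
qed

text \<open>Justifies the definite description in \<open>lm\<close>: a finite nonempty support has a
  greatest element, unique by antisymmetry.\<close>

lemma lm_max:
  assumes r: "monomial_ordering r" and f: "f \<noteq> 0"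
  shows "lm r f \<in> Poly_Mapping.keys f" and "s \<in> Poly_Mapping.keys f \<Longrightarrow> (s, lm r f) \<in> r"
proof -
  note lin = monomial_ordering_linear[OF r]
  have "\<exists>t\<in>A. \<forall>s\<in>A. (s, t) \<in> r" if "finite A" "A \<noteq> {}" for A
    using that
  proof (induction rule: finite_ne_induct)
    case (singleton x)
    then show ?case using lin(1) by simp
  next
    case (insert x A)
    then obtain t where t: "t \<in> A" "\<forall>s\<in>A. (s, t) \<in> r" by blast
    show ?case
    proof (cases "(x, t) \<in> r")
      case True
      with t show ?thesis by blast
    next
      case False
      then have "(t, x) \<in> r" using lin(4) by blast
      with t lin(1,2) show ?thesis by blast
    qed
  qed
  moreover have "Poly_Mapping.keys f \<noteq> {}"
    using f by (metis empty_iff in_keys_iff lookup_zero poly_mapping_eqI)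
  ultimately obtain t where t: "t \<in> Poly_Mapping.keys f" "\<forall>s\<in>Poly_Mapping.keys f. (s, t) \<in> r"
    using finite_keys by blast
  have "lm r f = t"
    unfolding lm_def using t lin(3) by (intro the_equality) auto
  with t show "lm r f \<in> Poly_Mapping.keys f"
    and "s \<in> Poly_Mapping.keys f \<Longrightarrow> (s, lm r f) \<in> r"
    by auto
qed

lemma lc_neq_0: "monomial_ordering r \<Longrightarrow> f \<noteq> 0 \<Longrightarrow> lc r f \<noteq> 0"
  using lm_max(1) by (auto simp: lc_def in_keys_iff)

text \<open>One division step: the multiple of \<open>h\<close> has the same coefficient at
  \<open>t\<close> as \<open>f\<close>, and compatibility of the ordering with products keeps its
  other monomials below \<open>t\<close>.\<close>

lemma reduction_step:
  fixes f h :: "('x, 'a::field) mpoly"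
  assumes r: "monomial_ordering r" and h: "h \<noteq> 0" and t: "t = u + lm r h"
    and f: "Poly_Mapping.keys f \<subseteq> {s. (s, t) \<in> r}"
  shows "Poly_Mapping.keys
      (f - Poly_Mapping.single u (Poly_Mapping.lookup f t / lc r h) * h) \<subseteq> {s. (s, t) \<in> r - Id}"
    (is "Poly_Mapping.keys (f - ?g) \<subseteq> _")
proof
  fix k assume k: "k \<in> Poly_Mapping.keys (f - ?g)"
  have "Poly_Mapping.lookup ?g t = Poly_Mapping.lookup f t"
    using lc_neq_0[OF r h] by (auto simp: t lookup_single_mult lc_def)
  then have "k \<noteq> t"
    using k by (auto simp: in_keys_iff lookup_minus)
  moreover have "(k, t) \<in> r"
  proof (cases "k \<in> Poly_Mapping.keys f")
    case True
    with f show ?thesis by blast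
  next
    case False
    then have "k \<in> Poly_Mapping.keys ?g"
      using k by (auto simp: in_keys_iff lookup_minus)
    then obtain s where "k = u + s" "s \<in> Poly_Mapping.keys h"
      using keys_mult by (fastforce split: if_splits)
    then show ?thesis
      using monomial_ordering_add[OF r lm_max(2)[OF r h]] t by simp
  qed
  ultimately show "k \<in> {s. (s, t) \<in> r - Id}"
    by simp
qed

text \<open>Given a strictly increasing chain, pick in each step a new element with
  smallest possible leading monomial; Dickson's lemma then yields a smaller one.\<close>

lemma noetherian_mpoly:
  fixes r :: "'x::finite monomial rel"
  assumes r: "monomial_ordering r"
  shows "noetherian TYPE(('x, 'a::field) mpoly)"
  unfolding noetherian_def wf_iff_no_infinite_down_chain
proof
  assume "\<exists>C. \<forall>i. (C (Suc i), C i) \<in>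
    {(B, A :: ('x, 'a) mpoly set). is_ideal A \<and> is_ideal B \<and> A \<subset> B}"
  then obtain C :: "nat \<Rightarrow> ('x, 'a) mpoly set"
    where id: "\<And>i. is_ideal (C i)" and less: "\<And>i. C i \<subset> C (Suc i)"
    by blast
  have mono: "C i \<subseteq> C j" if "i \<le> j" for i j
    using lift_Suc_mono_le[of C, OF psubset_imp_subset[OF less] that] .
  have "\<exists>f. f \<in> C (Suc i) - C i \<and> (\<forall>g\<in>C (Suc i) - C i. (lm r g, lm r f) \<notin> r - Id)" for i
  proof -
    have "C (Suc i) - C i \<noteq> {}"
      using less[of i] by blast
    then obtain f where "f \<in> C (Suc i) - C i"
      and min: "\<And>g. (g, f) \<in> inv_image (r - Id) (lm r) \<Longrightarrow> g \<notin> C (Suc i) - C i"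
      by (rule wfE_min'[OF wf_inv_image[OF monomial_ordering_wf[OF r], of "lm r"]]) (rule that)
    moreover have "(lm r g, lm r f) \<notin> r - Id" if "g \<in> C (Suc i) - C i" for g
      using min[of g] that unfolding in_inv_image by satx
    ultimately show ?thesis
      by (intro exI[of _ f] conjI ballI)
  qed
  then obtain f where f: "\<And>i. f i \<in> C (Suc i) - C i"
    and min: "\<And>i g. g \<in> C (Suc i) - C i \<Longrightarrow> (lm r g, lm r (f i)) \<notin> r - Id"
    by metis
  have f0: "f i \<noteq> 0" for i
    using f[of i] ideal_0[OF id[of i]] by auto
  obtain i j u where ij: "i < j" "lm r (f j) = u + lm r (f i)"
    using dickson_lemma[of "\<lambda>n. lm r (f n)"] by blast
  \<comment> \<open>\<open>q\<close> cancels the leading term of \<open>f j\<close> and lies in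
    \<open>C j\<close>, since \<open>f i\<close> entered the chain at stage
    \<open>Suc i \<le> j\<close>. Hence \<open>f j - q\<close> is still new at stage
    \<open>Suc j\<close> but has a smaller leading monomial than the minimal choice.\<close>
  define q where "q = Poly_Mapping.single u (lc r (f j) / lc r (f i)) * f i"
  have "q \<in> C j"
    unfolding q_def using f[of i] mono[of "Suc i" j] ij(1)
    by (intro ideal_mult_left id) auto
  have keys: "Poly_Mapping.keys (f j - q) \<subseteq> {s. (s, lm r (f j)) \<in> r - Id}"
    unfolding q_def lc_def[of r "f j"]
    using reduction_step[OF r f0 ij(2)] lm_max(2)[OF r f0] by blast
  have "f j - q \<in> C (Suc j)"
    using f[of j] \<open>q \<in> C j\<close> mono[of j "Suc j"] by (intro ideal_diff[OF id]) auto
  moreover have "f j - q \<notin> C j"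
    using f[of j] ideal_add[OF id[of j] _ \<open>q \<in> C j\<close>, of "f j - q"] by auto
  moreover from this have "f j - q \<noteq> 0"
    using ideal_0[OF id[of j]] by auto
  then have "(lm r (f j - q), lm r (f j)) \<in> r - Id"
    using lm_max(1)[OF r, of "f j - q"] keys by blast
  ultimately show False
    using min[of "f j - q" j] by blast
qed

text \<open>The polynomials whose monomials are all divisible by leading monomials of
  \<open>F\<close> form an ideal \<open>M\<close>; it contains the leading terms of
  \<open>F\<close>, hence also those of \<open>I\<close>.\<close>

lemma groebner_basis_lm:
  fixes f :: "('x, 'a::field) mpoly"
  assumes r: "monomial_ordering r" and F: "groebner_basis r F I" and f: "f \<in> I" "f \<noteq> 0"
  shows "\<exists>b\<in>F. \<exists>u. lm r f = u + lm r b"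
proof -
  define M :: "('x, 'a) mpoly set"
    where "M = {g. \<forall>k\<in>Poly_Mapping.keys g. \<exists>b\<in>F. \<exists>u. k = u + lm r b}"
  have "is_ideal M"
    unfolding is_ideal_def
  proof (intro conjI ballI allI)
    show "0 \<in> M" by (simp add: M_def)
  next
    fix x y assume "x \<in> M" "y \<in> M"
    then show "x + y \<in> M"
      using keys_add[of x y] unfolding M_def by blast
  next
    fix c x assume x: "x \<in> M"
    show "c * x \<in> M"
      unfolding M_def
    proof (intro CollectI ballI)
      fix k assume "k \<in> Poly_Mapping.keys (c * x)"
      then obtain a s where k: "k = a + s" "s \<in> Poly_Mapping.keys x"
        using keys_mult by blast
      then obtain b u where "b \<in> F" "s = u + lm r b"
        using x unfolding M_def by blast
      then have "k = (a + u) + lm r b"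
        using k by (simp add: add.assoc)
      with \<open>b \<in> F\<close> show "\<exists>b\<in>F. \<exists>u. k = u + lm r b"
        by blast
    qed
  qed
  moreover have "lt r ` F \<subseteq> M"
    by (force simp: M_def lt_def intro: exI[of _ 0] split: if_splits)
  ultimately have "ideal_gen (lt r ` F) \<subseteq> M"
    by (intro ideal_gen_minimal)
  moreover have "lt r f \<in> ideal_gen (lt r ` F)"
    using F f(1) ideal_gen_superset[of "lt r ` I"] unfolding groebner_basis_def by blast
  moreover have "lm r f \<in> Poly_Mapping.keys (lt r f)"
    using lc_neq_0[OF r f(2)] by (simp add: lt_def)
  ultimately show ?thesis
    unfolding M_def by blast
qed

section \<open>Division and reduction modulo a prime\<close>

lemma of_int_mod_ring_eq_0_iff: "(of_int k :: 'p::prime_card mod_ring) = 0 \<longleftrightarrow> int CARD('p) dvd k"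
  unfolding of_int_of_int_mod_ring by transfer (simp add: dvd_eq_mod_eq_0)

lemma not_dvd_mult:
  "\<not> int CARD('p::prime_card) dvd a \<Longrightarrow> \<not> int CARD('p) dvd b \<Longrightarrow> \<not> int CARD('p) dvd a * b"
  using prime_dvd_mult_iff[OF prime_card_int] by blast

lemma not_dvd_imp_neq_0: "\<not> int p dvd b \<Longrightarrow> (of_int b :: rat) \<noteq> 0"
  by auto

lemma Z_locE:
  assumes "q \<in> Z_loc CARD('p::prime_card)"
  obtains a b where "q = of_int a / of_int b" "\<not> int CARD('p) dvd b"
    "(red_coeff q :: 'p mod_ring) = of_int a / of_int b"
  using assms red_coeff_fraction unfolding Z_loc_def by blast

lemma Z_locI: "\<not> int p dvd b \<Longrightarrow> of_int a / of_int b \<in> Z_loc p"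
  by (auto simp: Z_loc_def)

lemma not_dvd_1: "\<not> int CARD('p::prime_card) dvd 1"
  using prime_card_int not_prime_unit by blast

lemma of_int_Z_loc: "of_int a \<in> Z_loc CARD('p::prime_card)"
  using Z_locI[OF not_dvd_1[where 'p='p], of a] by simp

lemma red_coeff_of_int: "red_coeff (of_int a) = (of_int a :: 'p::prime_card mod_ring)"
  using red_coeff_fraction[OF not_dvd_1[where 'p='p], of a] by simp

lemma red_coeff_0 [simp]: "red_coeff 0 = (0 :: 'p::prime_card mod_ring)"
  using red_coeff_of_int[of 0] by simp

lemma Z_loc_mult:
  assumes "q \<in> Z_loc CARD('p::prime_card)" "q' \<in> Z_loc CARD('p)"
  shows "q * q' \<in> Z_loc CARD('p)"
    and "red_coeff (q * q') = (red_coeff q * red_coeff q' :: 'p mod_ring)"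
proof -
  obtain a b where q: "q = of_int a / of_int b" "\<not> int CARD('p) dvd b"
    "(red_coeff q :: 'p mod_ring) = of_int a / of_int b"
    by (rule Z_locE[OF assms(1)])
  obtain a' b' where q': "q' = of_int a' / of_int b'" "\<not> int CARD('p) dvd b'"
    "(red_coeff q' :: 'p mod_ring) = of_int a' / of_int b'"
    by (rule Z_locE[OF assms(2)])
  have eq: "q * q' = of_int (a * a') / of_int (b * b')"
    by (simp add: q(1) q'(1))
  show "q * q' \<in> Z_loc CARD('p)"
    unfolding eq by (rule Z_locI[OF not_dvd_mult[OF q(2) q'(2)]])
  show "red_coeff (q * q') = (red_coeff q * red_coeff q' :: 'p mod_ring)"
    unfolding eq red_coeff_fraction[OF not_dvd_mult[OF q(2) q'(2)]] by (simp add: q(3) q'(3))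
qed

lemma Z_loc_add:
  assumes "q \<in> Z_loc CARD('p::prime_card)" "q' \<in> Z_loc CARD('p)"
  shows "q + q' \<in> Z_loc CARD('p)"
    and "red_coeff (q + q') = (red_coeff q + red_coeff q' :: 'p mod_ring)"
proof -
  obtain a b where q: "q = of_int a / of_int b" "\<not> int CARD('p) dvd b"
    "(red_coeff q :: 'p mod_ring) = of_int a / of_int b"
    by (rule Z_locE[OF assms(1)])
  obtain a' b' where q': "q' = of_int a' / of_int b'" "\<not> int CARD('p) dvd b'"
    "(red_coeff q' :: 'p mod_ring) = of_int a' / of_int b'"
    by (rule Z_locE[OF assms(2)])
  have eq: "q + q' = of_int (a * b' + a' * b) / of_int (b * b')"
    using not_dvd_imp_neq_0[OF q(2)] not_dvd_imp_neq_0[OF q'(2)]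
    by (simp add: q(1) q'(1) field_simps)
  show "q + q' \<in> Z_loc CARD('p)"
    unfolding eq by (rule Z_locI[OF not_dvd_mult[OF q(2) q'(2)]])
  show "red_coeff (q + q') = (red_coeff q + red_coeff q' :: 'p mod_ring)"
    unfolding eq red_coeff_fraction[OF not_dvd_mult[OF q(2) q'(2)]]
    using q(2) q'(2) by (simp add: q(3) q'(3) of_int_mod_ring_eq_0_iff add_frac_eq)
qed

text \<open>A nonzero residue means that the prime does not divide the numerator, so the inverted
  fraction is admissible. This makes the leading coefficients of permissible polynomials
  units.\<close>

lemma Z_loc_inverse:
  assumes "q \<in> Z_loc CARD('p::prime_card)" "(red_coeff q :: 'p mod_ring) \<noteq> 0"
  shows "inverse q \<in> Z_loc CARD('p)"
proof -
  obtain a b where q: "q = of_int a / of_int b" "(red_coeff q :: 'p mod_ring) = of_int a / of_int b"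
    using Z_locE[OF assms(1)] by metis
  then have "\<not> int CARD('p) dvd a"
    using assms(2) of_int_mod_ring_eq_0_iff[where 'p='p, of a] by auto
  then show ?thesis
    using Z_locI[of "CARD('p)" a b] q(1) by simp
qed

text \<open>A zero residue forces the prime to divide the numerator, where it can be
  cancelled.\<close>

lemma Z_loc_div_p:
  assumes "q \<in> Z_loc CARD('p::prime_card)" "(red_coeff q :: 'p mod_ring) = 0"
  shows "q / of_nat CARD('p) \<in> Z_loc CARD('p)"
proof -
  obtain a b where q: "q = of_int a / of_int b" "\<not> int CARD('p) dvd b"
    "(red_coeff q :: 'p mod_ring) = of_int a / of_int b"
    by (rule Z_locE[OF assms(1)])
  then have "(of_int a :: 'p mod_ring) = 0"
    using assms(2) of_int_mod_ring_eq_0_iff[where 'p='p, of b] by auto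
  then obtain k where "a = int CARD('p) * k"
    unfolding of_int_mod_ring_eq_0_iff by blast
  then have "q / of_nat CARD('p) = of_int k / of_int b"
    by (simp add: q(1))
  then show ?thesis
    using Z_locI[OF q(2)] by simp
qed

section \<open>Polynomials over the local ring and their reduction\<close>

lemma lookup_red_poly:
  "Poly_Mapping.lookup (red_poly f :: ('x, 'p::prime_card mod_ring) mpoly) t =
    red_coeff (Poly_Mapping.lookup f t)"
  by (simp add: red_poly_def Poly_Mapping.map.rep_eq when_def)

lemma red_poly_0 [simp]: "red_poly 0 = (0 :: ('x, 'p::prime_card mod_ring) mpoly)"
  by (rule poly_mapping_eqI) (simp add: lookup_red_poly)

lemma red_poly_single:
  "red_poly (Poly_Mapping.single t c) =
    (Poly_Mapping.single t (red_coeff c) :: ('x, 'p::prime_card mod_ring) mpoly)"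
  by (rule poly_mapping_eqI) (simp add: lookup_red_poly lookup_single when_def)

lemma Z_loc_poly_add:
  assumes "f \<in> Z_loc_poly CARD('p::prime_card)" "g \<in> Z_loc_poly CARD('p)"
  shows "f + g \<in> Z_loc_poly CARD('p)"
    and "red_poly (f + g) = (red_poly f + red_poly g :: ('x, 'p mod_ring) mpoly)"
  using assms Z_loc_add[where 'p='p]
  by (auto simp: Z_loc_poly_def lookup_add lookup_red_poly intro!: poly_mapping_eqI)

lemma Z_loc_poly_single:
  assumes "c \<in> Z_loc CARD('p::prime_card)"
  shows "Poly_Mapping.single t c \<in> Z_loc_poly CARD('p)"
  using assms of_int_Z_loc[where 'p='p, of 0]
  by (auto simp: Z_loc_poly_def lookup_single when_def)

lemma Z_loc_poly_single_mult:
  assumes "c \<in> Z_loc CARD('p::prime_card)" "g \<in> Z_loc_poly CARD('p)"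
  shows "Poly_Mapping.single t c * g \<in> Z_loc_poly CARD('p)"
    and "red_poly (Poly_Mapping.single t c * g) =
      (Poly_Mapping.single t (red_coeff c) * red_poly g :: ('x, 'p mod_ring) mpoly)"
proof -
  show "Poly_Mapping.single t c * g \<in> Z_loc_poly CARD('p)"
    using assms of_int_Z_loc[where 'p='p, of 0]
    by (auto simp: Z_loc_poly_def lookup_single_mult intro: Z_loc_mult)
  show "red_poly (Poly_Mapping.single t c * g) =
      (Poly_Mapping.single t (red_coeff c) * red_poly g :: ('x, 'p mod_ring) mpoly)"
    using assms Z_loc_mult(2)[where 'p='p]
    by (intro poly_mapping_eqI) (auto simp: Z_loc_poly_def lookup_single_mult lookup_red_poly)
qed

text \<open>Induction on the number of monomials, removing one term at a time; it extends
  multiplicativity of the reduction from single terms to all polynomials.\<close>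

lemma Z_loc_poly_induct [consumes 1, case_names zero add]:
  fixes f :: "('x, rat) mpoly"
  assumes "f \<in> Z_loc_poly p" and "Q 0"
    and add: "\<And>t c f. c \<in> Z_loc p \<Longrightarrow> f \<in> Z_loc_poly p \<Longrightarrow> Q f \<Longrightarrow> Q (Poly_Mapping.single t c + f)"
  shows "Q f"
  using assms(1)
proof (induction "card (Poly_Mapping.keys f)" arbitrary: f)
  case 0
  then have "f = 0"
    by simp
  with \<open>Q 0\<close> show ?case by simp
next
  case (Suc n)
  then obtain t where t: "t \<in> Poly_Mapping.keys f"
    by fastforce
  define c where "c = Poly_Mapping.lookup f t"
  define g where "g = f - Poly_Mapping.single t c"
  have lookup_g: "Poly_Mapping.lookup g s = (if s = t then 0 else Poly_Mapping.lookup f s)" for s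
    by (simp add: g_def c_def lookup_minus lookup_single when_def)
  have "Poly_Mapping.keys g = Poly_Mapping.keys f - {t}"
    by (auto simp: in_keys_iff lookup_g split: if_splits)
  \<comment> \<open>Here \<open>p\<close> is any natural number, and \<open>Z_loc 1\<close> is
    empty; a denominator of the coefficient \<open>c\<close> shows that \<open>Z_loc p\<close> is
    not.\<close>
  moreover have "0 \<in> Z_loc p"
  proof -
    obtain a b where "c = of_int a / of_int b" "\<not> int p dvd b"
      using Suc.prems unfolding Z_loc_poly_def Z_loc_def c_def by blast
    then show ?thesis
      using Z_locI[of p b 0] by simp
  qed
  then have "g \<in> Z_loc_poly p"
    using Suc.prems by (simp add: Z_loc_poly_def lookup_g)
  ultimately have "Q g" "g \<in> Z_loc_poly p"
    using Suc.hyps(1)[of g] Suc.hyps(2) t by simp_all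
  moreover have "c \<in> Z_loc p"
    using Suc.prems by (simp add: Z_loc_poly_def c_def)
  ultimately have "Q (Poly_Mapping.single t c + g)"
    by (intro add)
  then show ?case
    by (simp add: g_def)
qed

lemma Z_loc_poly_mult:
  fixes f g :: "('x, rat) mpoly"
  assumes f: "f \<in> Z_loc_poly CARD('p::prime_card)" and g: "g \<in> Z_loc_poly CARD('p)"
  shows "f * g \<in> Z_loc_poly CARD('p)"
    and "red_poly (f * g) = (red_poly f * red_poly g :: ('x, 'p mod_ring) mpoly)"
proof -
  have "f * g \<in> Z_loc_poly CARD('p) \<and>
    red_poly (f * g) = (red_poly f * red_poly g :: ('x, 'p mod_ring) mpoly)"
    using f
  proof (induction rule: Z_loc_poly_induct)
    case zero
    then show ?case
      using of_int_Z_loc[where 'p='p, of 0] by (simp add: Z_loc_poly_def)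
  next
    case (add t c f)
    then show ?case
      using g Z_loc_poly_single_mult[where 'p='p, of c g t]
        Z_loc_poly_add[where 'p='p, of "Poly_Mapping.single t c * g" "f * g"]
        Z_loc_poly_add(2)[where 'p='p, of "Poly_Mapping.single t c" f]
        Z_loc_poly_single[where 'p='p, of c t]
      by (simp add: distrib_right red_poly_single)
  qed
  then show "f * g \<in> Z_loc_poly CARD('p)"
    and "red_poly (f * g) = (red_poly f * red_poly g :: ('x, 'p mod_ring) mpoly)"
    by simp_all
qed

lemma Z_loc_poly_diff:
  assumes "f \<in> Z_loc_poly CARD('p::prime_card)" "g \<in> Z_loc_poly CARD('p)"
  shows "f - g \<in> Z_loc_poly CARD('p)"
    and "red_poly (f - g) = (red_poly f - red_poly g :: ('x, 'p mod_ring) mpoly)"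
proof -
  have "Poly_Mapping.single 0 (of_int (- 1)) * g = - g"
    by (rule poly_mapping_eqI) (simp only: lookup_single_0_mult lookup_uminus
        of_int_minus of_int_1 mult_minus_left mult_1_left)
  then have "f - g = f + Poly_Mapping.single 0 (of_int (- 1)) * g"
    by simp
  then show *: "f - g \<in> Z_loc_poly CARD('p)"
    using assms by (simp only: Z_loc_poly_add Z_loc_poly_single_mult of_int_Z_loc)
  \<comment> \<open>The rule for sums, applied to \<open>(f - g) + g\<close>, gives the one for
    differences.\<close>
  show "red_poly (f - g) = (red_poly f - red_poly g :: ('x, 'p mod_ring) mpoly)"
    using Z_loc_poly_add(2)[OF * assms(2)] by simp
qed

text \<open>The kernel of the reduction is generated by p, so a congruence modulo p becomes an
  equation over the local ring.\<close>

lemma Z_loc_poly_div_p: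
  assumes f: "f \<in> Z_loc_poly CARD('p::prime_card)"
    and red: "red_poly f = (0 :: ('x, 'p mod_ring) mpoly)"
  obtains s where "s \<in> Z_loc_poly CARD('p)" "f = Poly_Mapping.single 0 (of_nat CARD('p)) * s"
proof
  define s where "s = Poly_Mapping.single 0 (1 / of_nat CARD('p)) * f"
  have "red_coeff (Poly_Mapping.lookup f t) = (0 :: 'p mod_ring)" for t
    using red by (simp flip: lookup_red_poly)
  then show "s \<in> Z_loc_poly CARD('p)"
    using f Z_loc_div_p[where 'p='p] by (simp add: s_def Z_loc_poly_def lookup_single_0_mult)
  show "f = Poly_Mapping.single 0 (of_nat CARD('p)) * s"
    by (rule poly_mapping_eqI) (simp only: s_def lookup_single_0_mult, simp)
qed

text \<open>The lift uses the integer representatives \<open>to_int_mod_ring\<close> of the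
  residues.\<close>

lemma red_poly_surj:
  fixes h :: "('x, 'p::prime_card mod_ring) mpoly"
  obtains f where "f \<in> Z_loc_poly CARD('p)" "red_poly f = h"
proof
  define f :: "('x, rat) mpoly" where "f = Poly_Mapping.map (\<lambda>c. of_int (to_int_mod_ring c)) h"
  have f: "Poly_Mapping.lookup f t = of_int (to_int_mod_ring (Poly_Mapping.lookup h t))" for t
    by (simp add: f_def Poly_Mapping.map.rep_eq when_def)
  show "f \<in> Z_loc_poly CARD('p)"
    by (simp add: Z_loc_poly_def f of_int_Z_loc)
  show "red_poly f = h"
    by (rule poly_mapping_eqI) (simp add: lookup_red_poly f red_coeff_of_int of_int_of_int_mod_ring)
qed

section \<open>Clearing denominators and powers of p\<close>

text \<open>A product of denominators of the finitely many nonzero coefficients serves as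
  \<open>c\<close>.\<close>

lemma clear_denominators:
  fixes f :: "('x, rat) mpoly"
  obtains c where "c \<noteq> 0" "Poly_Mapping.single 0 c * f \<in> Z_loc_poly CARD('p::prime_card)"
proof -
  have "\<exists>c::int. c \<noteq> 0 \<and> (\<forall>t\<in>A. of_int c * Poly_Mapping.lookup f t \<in> Z_loc CARD('p))"
    if "finite A" for A
    using that
  proof induction
    case empty
    then show ?case by (intro exI[of _ 1]) simp
  next
    case (insert t A)
    then obtain c :: int where c: "c \<noteq> 0" "\<forall>t\<in>A. of_int c * Poly_Mapping.lookup f t \<in> Z_loc CARD('p)"
      by blast
    obtain a b where ab: "Poly_Mapping.lookup f t = of_int a / of_int b" "b \<noteq> 0"
      by (metis quotient_of_div quotient_of_denom_pos less_irrefl surj_pair)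
    have "of_int (b * c) * Poly_Mapping.lookup f s \<in> Z_loc CARD('p)" if "s \<in> insert t A" for s
    proof (cases "s \<in> A")
      case True
      then show ?thesis
        using c(2) Z_loc_mult(1)[OF of_int_Z_loc[where 'p='p, of b]] by (simp add: mult.assoc)
    next
      case False
      then have "of_int (b * c) * Poly_Mapping.lookup f s = of_int (c * a)"
        using that ab by simp
      then show ?thesis
        by (simp only: of_int_Z_loc)
    qed
    then show ?case
      using c(1) ab(2) by (intro exI[of _ "b * c"]) simp
  qed
  from this[OF finite_keys[of f]] obtain c :: int where c: "c \<noteq> 0"
    "\<forall>t\<in>Poly_Mapping.keys f. of_int c * Poly_Mapping.lookup f t \<in> Z_loc CARD('p)"
    by blast
  have "of_int c * Poly_Mapping.lookup f t \<in> Z_loc CARD('p)" for t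
    using c(2) of_int_Z_loc[where 'p='p, of 0] by (cases "t \<in> Poly_Mapping.keys f") (auto simp: in_keys_iff)
  then show ?thesis
    using that[of "of_int c"] c(1)
    by (simp add: Z_loc_poly_def lookup_single_0_mult del: single_of_int)
qed

text \<open>Division by p is repeated while the reduction vanishes. It ends because each division
  removes a factor p from the numerator of one fixed nonzero coefficient.\<close>

lemma scale_to_nonzero_reduction:
  fixes f :: "('x, rat) mpoly"
  assumes f: "f \<in> Z_loc_poly CARD('p::prime_card)" and "f \<noteq> 0"
  obtains c where "c \<noteq> 0" "Poly_Mapping.single 0 c * f \<in> Z_loc_poly CARD('p)"
    "red_poly (Poly_Mapping.single 0 c * f) \<noteq> (0 :: ('x, 'p mod_ring) mpoly)"
proof -
  obtain t where t: "Poly_Mapping.lookup f t \<noteq> 0"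
    using \<open>f \<noteq> 0\<close> by (metis lookup_zero poly_mapping_eqI)
  obtain a b where ab: "Poly_Mapping.lookup f t = of_int a / of_int b" "\<not> int CARD('p) dvd b"
    using f unfolding Z_loc_poly_def Z_loc_def by blast
  have "a \<noteq> 0" using t ab(1) by auto
  have "\<exists>c. c \<noteq> 0 \<and> Poly_Mapping.single 0 c * f \<in> Z_loc_poly CARD('p) \<and>
      red_poly (Poly_Mapping.single 0 c * f) \<noteq> (0 :: ('x, 'p mod_ring) mpoly)"
    using f ab(1) \<open>a \<noteq> 0\<close>
  proof (induction "nat \<bar>a\<bar>" arbitrary: f a rule: less_induct)
    case less
    show ?case
    proof (cases "red_poly f = (0 :: ('x, 'p mod_ring) mpoly)")
      case False
      then show ?thesis
        using less.prems(1) by (intro exI[of _ 1]) simp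
    next
      case True
      then obtain s where s: "s \<in> Z_loc_poly CARD('p)"
        and fs: "f = Poly_Mapping.single 0 (of_nat CARD('p)) * s"
        by (rule Z_loc_poly_div_p[OF less.prems(1)])
      have "(red_coeff (of_int a / of_int b) :: 'p mod_ring) = 0"
        using True less.prems(2) by (metis lookup_red_poly lookup_zero)
      then have "int CARD('p) dvd a"
        using ab(2) by (simp add: red_coeff_fraction of_int_mod_ring_eq_0_iff)
      then obtain k where k: "a = int CARD('p) * k"
        by blast
      have "\<bar>k\<bar> < \<bar>a\<bar>"
        using less.prems(3) prime_gt_1_int[OF prime_card_int[where 'a='p]]
        by (simp add: k abs_mult)
      moreover have "of_nat CARD('p) * Poly_Mapping.lookup s t = of_nat CARD('p) * (of_int k / of_int b)"
        using less.prems(2) unfolding fs lookup_single_0_mult k by simp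
      then have "Poly_Mapping.lookup s t = of_int k / of_int b"
        unfolding mult_cancel_left by simp
      moreover have "k \<noteq> 0"
        using less.prems(3) k by auto
      ultimately obtain c where c: "c \<noteq> 0" "Poly_Mapping.single 0 c * s \<in> Z_loc_poly CARD('p)"
        "red_poly (Poly_Mapping.single 0 c * s) \<noteq> (0 :: ('x, 'p mod_ring) mpoly)"
        using less.hyps[of k s] less.prems(3) s by auto
      have "Poly_Mapping.single 0 (c / of_nat CARD('p)) * f = Poly_Mapping.single 0 c * s"
        by (simp add: fs mult_single del: single_of_nat flip: mult.assoc)
      then show ?thesis
        using c by (intro exI[of _ "c / of_nat CARD('p)"]) simp
    qed
  qed
  then show ?thesis
    using that by blast
qed

section \<open>Standard remainders and division\<close>

lemma permissible_neq_0:
  "permissible TYPE('p::prime_card) r F \<Longrightarrow> b \<in> F \<Longrightarrow> b \<noteq> 0"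
  by (auto simp: permissible_def lc_def)

text \<open>The normal forms with respect to \<open>F\<close>, that is, the possible remainders of a
  division by \<open>F\<close>.\<close>

definition standard :: "'x monomial rel \<Rightarrow> ('x, 'a::zero) mpoly set \<Rightarrow> ('x, 'a) mpoly \<Rightarrow> bool"
  where "standard r F h \<longleftrightarrow>
    (\<forall>t\<in>Poly_Mapping.keys h. \<forall>b\<in>F. \<forall>u. t \<noteq> u + lm r b)"

lemma standard_add: "standard r F f \<Longrightarrow> standard r F g \<Longrightarrow> standard r F (f + g)"
  unfolding standard_def using keys_add[of f g] by blast

lemma standard_single_0_mult: "standard r F f \<Longrightarrow> standard r F (Poly_Mapping.single 0 c * f)"
  for f :: "('x, 'a::semiring_0) mpoly"
proof -
  have "Poly_Mapping.keys (Poly_Mapping.single 0 c * f) \<subseteq> Poly_Mapping.keys f"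
    by (auto simp: in_keys_iff lookup_single_0_mult)
  then show "standard r F f \<Longrightarrow> standard r F (Poly_Mapping.single 0 c * f)"
    unfolding standard_def by blast
qed

text \<open>This is uniqueness of remainders: the leading monomial of a nonzero element of
  \<open>I\<close> would be divisible by one from \<open>F\<close>.\<close>

lemma standard_ideal_eq_0:
  fixes h :: "('x, 'a::field) mpoly"
  assumes "monomial_ordering r" "groebner_basis r F I" "h \<in> I" "standard r F h"
  shows "h = 0"
  using groebner_basis_lm[OF assms(1-3)] lm_max(1)[OF assms(1), of h] assms(4)
  unfolding standard_def by blast

text \<open>Division works over the local ring, since the leading coefficients of the divisors are units.\<close>

lemma Z_loc_division:
  fixes f :: "('x, rat) mpoly"
  assumes r: "monomial_ordering r" and F: "permissible TYPE('p::prime_card) r F"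
    and "f \<in> Z_loc_poly CARD('p)"
  shows "\<exists>g h. f = g + h \<and> g \<in> Z_loc_poly CARD('p) \<and> h \<in> Z_loc_poly CARD('p) \<and>
    g \<in> ideal_gen F \<and> red_poly g \<in> (red_ideal F :: ('x, 'p mod_ring) mpoly set) \<and> standard r F h"
    (is "?P f")
proof -
  have zero: "?P 0"
    using of_int_Z_loc[where 'p='p, of 0]
    by (intro exI[of _ 0]) (simp add: Z_loc_poly_def standard_def red_ideal_def
        ideal_0[OF is_ideal_ideal_gen])
  \<comment> \<open>The induction runs on a bound \<open>t\<close> for the monomials of
    \<open>f\<close>; \<open>t\<close> itself need not occur in \<open>f\<close>.\<close>
  have "?P f" if "f \<in> Z_loc_poly CARD('p)" "Poly_Mapping.keys f \<subseteq> {s. (s, t) \<in> r}" for f t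
    using that
  proof (induction t arbitrary: f rule: wf_induct_rule[OF monomial_ordering_wf[OF r]])
    case (1 t)
    \<comment> \<open>A strict bound \<open>t\<close> can be replaced by the leading monomial of
      \<open>g\<close>, which is smaller; the zero polynomial has none and is treated apart.\<close>
    have IH: "?P g" if g: "g \<in> Z_loc_poly CARD('p)" "Poly_Mapping.keys g \<subseteq> {s. (s, t) \<in> r - Id}" for g
    proof (cases "g = 0")
      case True
      with zero show ?thesis by simp
    next
      case False
      have "(lm r g, t) \<in> r - Id"
        using lm_max(1)[OF r False] g(2) by blast
      moreover have "Poly_Mapping.keys g \<subseteq> {s. (s, lm r g) \<in> r}"
        using lm_max(2)[OF r False] by blast
      ultimately show ?thesis
        using "1.IH" g(1) by blast
    qed
    define c where "c = Poly_Mapping.lookup f t"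
    have c: "c \<in> Z_loc CARD('p)"
      using "1.prems"(1) by (simp add: Z_loc_poly_def c_def)
    show ?case
    proof (cases "\<exists>b\<in>F. \<exists>u. t = u + lm r b")
      case True
      then obtain b u where b: "b \<in> F" and t: "t = u + lm r b"
        by blast
      \<comment> \<open>The multiplier cancels the term of \<open>f\<close> at \<open>t\<close>; its
        coefficient stays in the local ring because \<open>lc r b\<close> is a unit there.\<close>
      define q where "q = Poly_Mapping.single u (c / lc r b)"
      have bZ: "b \<in> Z_loc_poly CARD('p)" and lcb: "(red_coeff (lc r b) :: 'p mod_ring) \<noteq> 0"
        using F b by (auto simp: permissible_def)
      then have "inverse (lc r b) \<in> Z_loc CARD('p)"
        by (intro Z_loc_inverse) (auto simp: Z_loc_poly_def lc_def)
      then have q: "q \<in> Z_loc_poly CARD('p)"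
        unfolding q_def divide_inverse by (intro Z_loc_poly_single Z_loc_mult(1) c)
      have qb: "q * b \<in> Z_loc_poly CARD('p)"
        by (rule Z_loc_poly_mult(1)[OF q bZ])
      have "?P (f - q * b)"
        using reduction_step[OF r permissible_neq_0[OF F b] t "1.prems"(2)]
        by (intro IH Z_loc_poly_diff(1) "1.prems"(1) qb) (simp add: q_def c_def)
      then obtain g h where gh: "f - q * b = g + h" "g \<in> Z_loc_poly CARD('p)"
        "h \<in> Z_loc_poly CARD('p)" "g \<in> ideal_gen F"
        "red_poly g \<in> (red_ideal F :: ('x, 'p mod_ring) mpoly set)" "standard r F h"
        by blast
      have "f = (q * b + g) + h"
        using gh(1) by (simp add: algebra_simps)
      moreover have "q * b \<in> ideal_gen F"
        using b ideal_gen_superset[of F] by (intro ideal_mult_left is_ideal_ideal_gen) blast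
      then have "q * b + g \<in> ideal_gen F"
        using gh(4) by (intro ideal_add is_ideal_ideal_gen)
      \<comment> \<open>Both factors have coefficients in the local ring, so the reduction respects
        the product.\<close>
      moreover have "red_poly (q * b) \<in> (red_ideal F :: ('x, 'p mod_ring) mpoly set)"
        unfolding Z_loc_poly_mult(2)[OF q bZ] red_ideal_def
        using b ideal_gen_superset[of "red_poly ` F"]
        by (intro ideal_mult_left is_ideal_ideal_gen) blast
      then have "red_poly (q * b + g) \<in> (red_ideal F :: ('x, 'p mod_ring) mpoly set)"
        unfolding Z_loc_poly_add(2)[OF qb gh(2)] using gh(5) unfolding red_ideal_def
        by (intro ideal_add is_ideal_ideal_gen)
      ultimately show ?thesis
        using Z_loc_poly_add(1)[OF qb gh(2)] gh(3,6) by blast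
    next
      case False
      \<comment> \<open>No leading monomial divides \<open>t\<close>, so the term at
        \<open>t\<close> is moved to the remainder.\<close>
      define m where "m = Poly_Mapping.single t c"
      have m: "m \<in> Z_loc_poly CARD('p)"
        unfolding m_def by (rule Z_loc_poly_single[OF c])
      have "Poly_Mapping.keys (f - m) \<subseteq> {s. (s, t) \<in> r - Id}"
        using "1.prems"(2) by (auto simp: m_def c_def in_keys_iff lookup_minus lookup_single when_def
            split: if_splits)
      then have "?P (f - m)"
        by (intro IH Z_loc_poly_diff(1) "1.prems"(1) m)
      then obtain g h where gh: "f - m = g + h" "g \<in> Z_loc_poly CARD('p)"
        "h \<in> Z_loc_poly CARD('p)" "g \<in> ideal_gen F"
        "red_poly g \<in> (red_ideal F :: ('x, 'p mod_ring) mpoly set)" "standard r F h"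
        by blast
      have "standard r F m"
        using False by (auto simp: standard_def m_def split: if_splits)
      then have "standard r F (m + h)"
        using gh(6) by (rule standard_add)
      moreover have "f = g + (m + h)"
        using gh(1) by (simp add: algebra_simps)
      ultimately show ?thesis
        using gh(2,4,5) Z_loc_poly_add(1)[OF m gh(3)] by blast
    qed
  qed
  note main = this
  show ?thesis
  proof (cases "f = 0")
    case True
    with zero show ?thesis by simp
  next
    case False
    then show ?thesis
      using main[OF assms(3), of "lm r f"] lm_max(2)[OF r False] by blast
  qed
qed

section \<open>Reduction of ideals given by Groebner bases\<close>

text \<open>The definition of \<open>groebner_basis\<close> only compares leading terms. After
  clearing denominators, division leaves a standard remainder in \<open>I\<close>, which must
  vanish.\<close>

lemma groebner_basis_ideal_gen:
  fixes I :: "('x, rat) mpoly set"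
  assumes r: "monomial_ordering r" and I: "is_ideal I" and F: "groebner_basis r F I"
    and perm: "permissible TYPE('p::prime_card) r F"
  shows "ideal_gen F = I"
proof
  show "ideal_gen F \<subseteq> I"
    using F I by (intro ideal_gen_minimal) (simp_all add: groebner_basis_def)
  then have sub: "g \<in> I" if "g \<in> ideal_gen F" for g
    using that by blast
  show "I \<subseteq> ideal_gen F"
  proof
    fix f assume f: "f \<in> I"
    obtain c where c: "c \<noteq> 0" "Poly_Mapping.single 0 c * f \<in> Z_loc_poly CARD('p)"
      by (rule clear_denominators)
    obtain g h where gh: "Poly_Mapping.single 0 c * f = g + h" "g \<in> ideal_gen F" "standard r F h"
      using Z_loc_division[OF r perm c(2)] by blast
    have "h = Poly_Mapping.single 0 c * f - g"
      using gh(1) by simp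
    then have "h \<in> I"
      using ideal_diff[OF I ideal_mult_left[OF I f] sub[OF gh(2)]] by simp
    then have "h = 0"
      using standard_ideal_eq_0[OF r F _ gh(3)] by simp
    then have "Poly_Mapping.single 0 (1 / c) * (Poly_Mapping.single 0 c * f) \<in> ideal_gen F"
      using gh(1,2) by (simp add: ideal_mult_left is_ideal_ideal_gen)
    then show "f \<in> ideal_gen F"
      using c(1) by (simp add: mult_single flip: mult.assoc)
  qed
qed

text \<open>Division over the local ring leaves remainder zero, so \<open>f\<close> equals the part
  whose reduction is already known to lie in \<open>red_ideal F\<close>.\<close>

lemma red_poly_in_red_ideal:
  fixes I :: "('x, rat) mpoly set"
  assumes r: "monomial_ordering r" and I: "is_ideal I" and F: "groebner_basis r F I"
    and perm: "permissible TYPE('p::prime_card) r F"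
    and f: "f \<in> I" "f \<in> Z_loc_poly CARD('p)"
  shows "red_poly f \<in> (red_ideal F :: ('x, 'p mod_ring) mpoly set)"
proof -
  obtain g h where gh: "f = g + h" "g \<in> ideal_gen F" "standard r F h"
    "red_poly g \<in> (red_ideal F :: ('x, 'p mod_ring) mpoly set)"
    using Z_loc_division[OF r perm f(2)] by blast
  have "h = f - g"
    using gh(1) by simp
  then have "h \<in> I"
    using gh(2) f(1) groebner_basis_ideal_gen[OF r I F perm] ideal_diff[OF I] by blast
  then have "h = 0"
    using standard_ideal_eq_0[OF r F _ gh(3)] by simp
  with gh show ?thesis
    by simp
qed

text \<open>The image on the right is an ideal because every multiplier over the residue field lifts
  to the local ring, and it contains the generators.\<close>

lemma red_ideal_lift:
  fixes P :: "('x, rat) mpoly set"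
  assumes P: "is_ideal P" and G: "G \<subseteq> P" "G \<subseteq> Z_loc_poly CARD('p::prime_card)"
  shows "(red_ideal G :: ('x, 'p mod_ring) mpoly set) \<subseteq> red_poly ` (P \<inter> Z_loc_poly CARD('p))"
  unfolding red_ideal_def
proof (rule ideal_gen_minimal)
  show "red_poly ` G \<subseteq> red_poly ` (P \<inter> Z_loc_poly CARD('p))"
    using G by blast
  show "is_ideal (red_poly ` (P \<inter> Z_loc_poly CARD('p)) :: ('x, 'p mod_ring) mpoly set)"
    unfolding is_ideal_def
  proof (intro conjI ballI allI)
    have "0 \<in> P \<inter> Z_loc_poly CARD('p)"
      using of_int_Z_loc[where 'p='p, of 0] ideal_0[OF P] by (simp add: Z_loc_poly_def)
    then show "0 \<in> (red_poly ` (P \<inter> Z_loc_poly CARD('p)) :: ('x, 'p mod_ring) mpoly set)"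
      by force
  next
    fix x y :: "('x, 'p mod_ring) mpoly"
    assume "x \<in> red_poly ` (P \<inter> Z_loc_poly CARD('p))" "y \<in> red_poly ` (P \<inter> Z_loc_poly CARD('p))"
    then obtain f g where "x = red_poly f" "y = red_poly g"
      "f \<in> P" "g \<in> P" and Z: "f \<in> Z_loc_poly CARD('p)" "g \<in> Z_loc_poly CARD('p)"
      by blast
    then have "x + y = red_poly (f + g)" "f + g \<in> P \<inter> Z_loc_poly CARD('p)"
      using Z_loc_poly_add[OF Z] ideal_add[OF P] by auto
    then show "x + y \<in> red_poly ` (P \<inter> Z_loc_poly CARD('p))"
      by blast
  next
    fix c x :: "('x, 'p mod_ring) mpoly"
    assume "x \<in> red_poly ` (P \<inter> Z_loc_poly CARD('p))"
    then obtain f where "x = red_poly f" "f \<in> P" and f: "f \<in> Z_loc_poly CARD('p)"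
      by blast
    moreover obtain d where d: "d \<in> Z_loc_poly CARD('p)" "red_poly d = c"
      by (rule red_poly_surj)
    ultimately have "c * x = red_poly (d * f)" "d * f \<in> P \<inter> Z_loc_poly CARD('p)"
      using Z_loc_poly_mult[OF d(1) f] ideal_mult_left[OF P] by auto
    then show "c * x \<in> red_poly ` (P \<inter> Z_loc_poly CARD('p))"
      by blast
  qed
qed

text \<open>A standard \<open>h\<close> with \<open>red_poly h\<close> in \<open>red_ideal G\<close> is congruent modulo \<open>P\<close> to \<open>p * s\<close>, hence equal
  to \<open>p\<close> times the remainder of \<open>s\<close>.\<close>

lemma standard_red_poly_eq_0:
  fixes P :: "('x, rat) mpoly set"
  assumes r: "monomial_ordering r" and P: "is_ideal P" and G: "groebner_basis r G P"
    and perm: "permissible TYPE('p::prime_card) r G"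
    and h: "h \<in> Z_loc_poly CARD('p)" "standard r G h"
    and red: "red_poly h \<in> (red_ideal G :: ('x, 'p mod_ring) mpoly set)"
  shows "red_poly h = (0 :: ('x, 'p mod_ring) mpoly)"
proof -
  have "G \<subseteq> P" "G \<subseteq> Z_loc_poly CARD('p)"
    using G perm by (auto simp: groebner_basis_def permissible_def)
  then have "red_poly h \<in> (red_poly ` (P \<inter> Z_loc_poly CARD('p)) :: ('x, 'p mod_ring) mpoly set)"
    using red_ideal_lift[OF P] red by blast
  then obtain g where g: "g \<in> P" "g \<in> Z_loc_poly CARD('p)"
    and eq: "red_poly g = (red_poly h :: ('x, 'p mod_ring) mpoly)"
    by auto
  define pc :: "('x, rat) mpoly" where "pc = Poly_Mapping.single 0 (of_nat CARD('p))"
  have "red_poly (h - g) = (0 :: ('x, 'p mod_ring) mpoly)"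
    using Z_loc_poly_diff(2)[OF h(1) g(2)] eq by simp
  then obtain s where s: "s \<in> Z_loc_poly CARD('p)" "h - g = pc * s"
    using Z_loc_poly_div_p[OF Z_loc_poly_diff(1)[OF h(1) g(2)]] unfolding pc_def by blast
  obtain s1 s2 where s12: "s = s1 + s2" "s1 \<in> ideal_gen G" "s2 \<in> Z_loc_poly CARD('p)"
    "standard r G s2"
    using Z_loc_division[OF r perm s(1)] by blast
  have "s1 \<in> P"
    using s12(2) groebner_basis_ideal_gen[OF r P G perm] by simp
  \<comment> \<open>The difference of \<open>h\<close> and p times \<open>s2\<close> is written as a
    sum to fit \<open>standard_add\<close>; it lies in \<open>P\<close>, so it vanishes.\<close>
  have "h + Poly_Mapping.single 0 (- of_nat CARD('p)) * s2 = g + pc * s1"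
    using s(2) s12(1) by (simp add: pc_def single_uminus algebra_simps)
  also have "\<dots> \<in> P"
    by (intro ideal_add[OF P] ideal_mult_left[OF P] g(1) \<open>s1 \<in> P\<close>)
  finally have "h + Poly_Mapping.single 0 (- of_nat CARD('p)) * s2 = 0"
    by (rule standard_ideal_eq_0[OF r G])
      (intro standard_add standard_single_0_mult h(2) s12(4))
  then have "h = pc * s2"
    by (simp add: pc_def single_uminus add_eq_0_iff)
  moreover have "(red_coeff (of_nat CARD('p)) :: 'p mod_ring) = 0"
    using red_coeff_of_int[where 'p='p, of "int CARD('p)"]
      of_int_mod_ring_eq_0_iff[where 'p='p, of "int CARD('p)"] by simp
  moreover have "of_nat CARD('p) \<in> Z_loc CARD('p)"
    using of_int_Z_loc[where 'p='p, of "int CARD('p)"] by simp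
  ultimately show ?thesis
    using Z_loc_poly_single_mult(2)[OF _ s12(3)] by (simp add: pc_def del: single_of_nat)
qed

theorem theorem2p2p9:
  fixes r :: "('x::finite) monomial rel"
    and I P F G Kcan :: "('x, rat) mpoly set"
  assumes "monomial_ordering r"
    and "is_ideal I" and "prime_ideal P"
    and "groebner_basis r F I" and "groebner_basis r G P"
    and "permissible TYPE('p::prime_card) r F" and "permissible TYPE('p) r G"
    and "colon (red_ideal F) (red_ideal G) =
      (red_poly ` (colon (ideal_gen F) (ideal_gen G) \<inter> Z_loc_poly CARD('p))
        :: ('x, 'p mod_ring) mpoly set)"
    and "finite Kcan"
    and "permissible TYPE('p) r Kcan"
    and "groebner_basis r (red_poly ` Kcan)
      (colon (red_ideal F) (colon (red_ideal F) (red_ideal G))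
        :: ('x, 'p mod_ring) mpoly set)"
    and "colon (red_ideal F) (colon (red_ideal F) (red_ideal G)) =
      (red_ideal G :: ('x, 'p mod_ring) mpoly set)"
    and "Kcan \<subseteq> P"
  shows "prime_divisor P I"
proof (rule prime_divisorI[OF noetherian_mpoly[OF assms(1)] assms(2,3)])
  note r = assms(1) and I = assms(2) and F = assms(4) and G = assms(5)
    and permF = assms(6) and permG = assms(7) and red_colon = assms(8)
  have P: "is_ideal P"
    using assms(3) by (simp add: prime_ideal_def)
  define J where "J = colon I (colon I P)"
  have J: "is_ideal J"
    unfolding J_def by (rule is_ideal_colon[OF I])
  have gen: "ideal_gen F = I" "ideal_gen G = P"
    using groebner_basis_ideal_gen[OF r I F permF] groebner_basis_ideal_gen[OF r P G permG]
    by auto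
  \<comment> \<open>The colon hypothesis lifts each \<open>k\<close> to an element \<open>h\<close>
    of \<open>colon I P\<close>. Then \<open>f * h\<close> lies in \<open>I\<close> and reduces into
    \<open>red_ideal F\<close>; the hypothesis on the double colon finishes.\<close>
  have red_J: "red_poly f \<in> (red_ideal G :: ('x, 'p mod_ring) mpoly set)"
    if f: "f \<in> J" "f \<in> Z_loc_poly CARD('p)" for f
  proof -
    have "red_poly f * k \<in> (red_ideal F :: ('x, 'p mod_ring) mpoly set)"
      if k: "k \<in> colon (red_ideal F) (red_ideal G)" for k
    proof -
      obtain h where h: "k = red_poly h" "h \<in> colon I P" "h \<in> Z_loc_poly CARD('p)"
        using k unfolding red_colon gen by blast
      have "f * h \<in> I"
        using f(1) h(2) unfolding J_def colon_def[of I "colon I P"] by blast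
      then show ?thesis
        using red_poly_in_red_ideal[OF r I F permF _ Z_loc_poly_mult(1)[OF f(2) h(3)]]
          Z_loc_poly_mult(2)[OF f(2) h(3)] h(1) by simp
    qed
    then have "red_poly f \<in> colon (red_ideal F)
        (colon (red_ideal F) (red_ideal G) :: ('x, 'p mod_ring) mpoly set)"
      unfolding colon_def[of "red_ideal F" "colon _ _"] by blast
    then show ?thesis
      unfolding assms(12) .
  qed
  have "f \<in> P" if f: "f \<in> J" for f
  proof -
    obtain c where c: "c \<noteq> 0" "Poly_Mapping.single 0 c * f \<in> Z_loc_poly CARD('p)"
      by (rule clear_denominators)
    obtain g h where gh: "Poly_Mapping.single 0 c * f = g + h" "g \<in> P"
      "h \<in> Z_loc_poly CARD('p)" "standard r G h"
      using Z_loc_division[OF r permG c(2)] gen(2) by blast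
    have "h = Poly_Mapping.single 0 c * f - g"
      using gh(1) by simp
    \<comment> \<open>The subtracted \<open>g\<close> lies in \<open>P\<close>, which is contained
      in \<open>J\<close>.\<close>
    then have "h \<in> J"
      using ideal_diff[OF J ideal_mult_left[OF J f]] subset_double_colon[of P I] gh(2)
      unfolding J_def by blast
    have "h = 0"
    proof (rule ccontr)
      assume "h \<noteq> 0"
      \<comment> \<open>Scaling keeps the remainder standard and in \<open>J\<close>, so its nonzero
        reduction lies in \<open>red_ideal G\<close>, against
        \<open>standard_red_poly_eq_0\<close>.\<close>
      then obtain d where d: "Poly_Mapping.single 0 d * h \<in> Z_loc_poly CARD('p)"
        "red_poly (Poly_Mapping.single 0 d * h) \<noteq> (0 :: ('x, 'p mod_ring) mpoly)"
        using scale_to_nonzero_reduction[OF gh(3)] by blast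
      then show False
        using standard_red_poly_eq_0[OF r P G permG d(1) standard_single_0_mult[OF gh(4)]]
          red_J[OF ideal_mult_left[OF J \<open>h \<in> J\<close>] d(1)] by blast
    qed
    \<comment> \<open>Multiplication by the inverse constant undoes the clearing of
      denominators.\<close>
    then have "Poly_Mapping.single 0 (1 / c) * (Poly_Mapping.single 0 c * f) \<in> P"
      using gh(1,2) by (simp add: ideal_mult_left[OF P])
    then show "f \<in> P"
      using c(1) by (simp add: mult_single flip: mult.assoc)
  qed
  then show "colon I (colon I P) \<subseteq> P"
    unfolding J_def by blast
qed

end
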